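(* Let $(H;\langle\cdot,\cdot\rangle)$ be an infinite dimensional Hilbert space over $\mathbb{K}$, $(e_i)_{i\in\mathbb{N}}$ an orthonormal family in $H$, $\lambda=(\lambda_i)_{i\in\mathbb{N}}\in\ell^2(\mathbb{K})$ with $\lambda\neq0$, and $r>0$. If $x\in H$ is such that $$\left\|x-\sum_{i=1}^\infty\lambda_ie_i\right\|\le r,$$ then $$0\le\|x\|-\left(\sum_{i=1}^\infty|\langle x,e_i\rangle|^2\right)^{1/2}\le\frac12\cdot\frac{r^2}{\left(\sum_{i=1}^\infty|\lambda_i|^2\right)^{1/2}} .$$ The constant $\frac12$ is best possible, in the sense that it cannot be replaced by a smaller constant: there is no $c<\frac12$ such that the second inequality holds with $c$ in place of $\frac12$ for all infinite dimensional Hilbert spaces $H$ over $\mathbb{K}$, all orthonormal families $(e_i)_{i\in\mathbb{N}}$ in $H$, all $\lambda\in\ell^2(\mathbb{K})$ with $\lambda\neq0$, all $r>0$ and all $x\in H$ with $\left\|x-\sum_{i=1}^\infty\lambda_ie_i\right\|\le r$.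
   Context: $\mathbb{K}$ denotes $\mathbb{R}$ or $\mathbb{C}$. Inner products are linear in the first argument and conjugate-linear in the second, and $\|x\|=\langle x,x\rangle^{1/2}$. A family $(e_i)_{i\in\mathbb{N}}$ is orthonormal if $\langle e_i,e_j\rangle=0$ for $i\ne j$ and $\|e_i\|=1$ for all $i$; it is not assumed to be complete. $\ell^2(\mathbb{K})$ is the space of sequences $(a_i)_{i\in\mathbb{N}}$ in $\mathbb{K}$ with $\sum_{i=1}^\infty|a_i|^2<\infty$; for $\lambda\in\ell^2(\mathbb{K})$ the series $\sum_i\lambda_ie_i$ converges in $H$. *)

theory Defs
  imports
    "HOL-Analysis.Analysis"
    "HOL-Library.Function_Algebras"
    "Jordan_Normal_Form.Conjugate"
begin

text \<open>
  The scalar fields. The instances below are the reals and the complex numbers, and up to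
  isometric isomorphism there are no others, see \<open>real_or_complex_cases\<close>.
\<close>

class real_or_complex = real_normed_field + conjugatable_field +
  assumes mult_conjugate_scaleR: "a * conjugate a = (norm a)\<^sup>2 *\<^sub>R 1"

instance real :: real_or_complex
  by intro_classes (simp add: power2_eq_square)

instance complex :: real_or_complex
  by intro_classes
    (simp add: complex_norm_square [symmetric] scaleR_conv_of_real del: of_real_power)

lemma mult_conjugate: "a * conjugate a = of_real ((norm a)\<^sup>2)"
  for a :: "'k::real_or_complex"
  by (simp add: mult_conjugate_scaleR scaleR_conv_of_real)

lemma real_or_complex_cases:
  obtains (real) "\<And>a::'k::real_or_complex. a \<in> \<real>"
      and "\<And>a::'k::real_or_complex. conjugate a = a"
  | (complex) j :: "'k::real_or_complex" where "j * j = -1"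
      and "\<And>a::'k::real_or_complex. \<exists>s t. a = of_real s + of_real t * j"
      and "\<And>s t. conjugate (of_real s + of_real t * j) = of_real s - of_real t * j"
      and "\<And>s t. norm (of_real s + of_real t * j) = sqrt (s\<^sup>2 + t\<^sup>2)"
proof -
  have conj_real: "conjugate (of_real s :: 'k) = of_real s" for s
  proof (cases "s = 0")
    case False
    have "(of_real s :: 'k) * conjugate (of_real s) = of_real s * of_real s"
      by (simp add: mult_conjugate power2_eq_square)
    then show ?thesis using False by simp
  qed simp
  have conj_one: "conjugate (1::'k) = 1" using conj_real[of 1] by simp
  have trace: "\<exists>s. a + conjugate a = of_real s" for a :: 'k
  proof -
    have "(1 + a) * conjugate (1 + a) = 1 + (a + conjugate a) + a * conjugate a"
      by (simp add: conjugate_dist_add conj_one algebra_simps)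
    then have "a + conjugate a = of_real ((norm (1 + a))\<^sup>2 - 1 - (norm a)\<^sup>2)"
      by (simp add: mult_conjugate algebra_simps)
    then show ?thesis by blast
  qed
  show thesis
  proof (cases "\<forall>a::'k. conjugate a = a")
    case True
    have "a \<in> \<real>" for a :: 'k
    proof -
      obtain s where "a + a = of_real s" using trace[of a] True by auto
      then have "a = of_real (s / 2)" by (simp add: eq_divide_eq mult_2_right)
      then show ?thesis by (metis Reals_of_real)
    qed
    then show thesis using True real by blast
  next
    case False
    then obtain b :: 'k where b: "conjugate b \<noteq> b" by blast
    define d where "d = b - conjugate b"
    have d0: "d \<noteq> 0" using b by (simp add: d_def)
    have conj_minus: "conjugate (u - v) = conjugate u - conjugate v" for u v :: 'k
      using conjugate_dist_add[of u "- v"] by (simp add: conjugate_neg)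
    have cd: "conjugate d = - d" by (simp add: d_def conj_minus)
    define j where "j = of_real (1 / norm d) * d"
    have nj: "norm j = 1" using d0 by (simp add: j_def norm_divide)
    have cj: "conjugate j = - j" by (simp only: j_def conjugate_dist_mul conj_real cd)
      simp
    have jj: "j * j = - 1"
      using mult_conjugate[of j] by (simp add: cj nj eq_neg_iff_add_eq_0)
        (metis add.commute neg_eq_iff_add_eq_0)
    have dec: "\<exists>s t. a = of_real s + of_real t * j" for a
    proof -
      obtain s where s: "a + conjugate a = of_real s" using trace by blast
      obtain t where t: "a * j + conjugate (a * j) = of_real t" using trace by blast
      have "(a - conjugate a) * j = of_real t"
        using t by (simp add: conjugate_dist_mul cj algebra_simps)
      then have "(a - conjugate a) * (j * j) = of_real t * j" by (simp add: mult.assoc)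
      then have "a - conjugate a = - of_real t * j" by (simp add: jj) (metis minus_diff_eq)
      then have "a + a = of_real s - of_real t * j" using s
        by (metis (no_types, lifting) add_diff_cancel_left' diff_add_eq diff_conv_add_uminus add_diff_eq add.commute mult_minus_left)
      then have "a * 2 = of_real s - of_real t * j" by (simp add: mult_2_right)
      then have "a = (of_real s - of_real t * j) / 2" by (simp add: eq_divide_eq)
      then have "a = of_real (s / 2) + of_real (- t / 2) * j" by (simp add: diff_divide_distrib)
      then show ?thesis by blast
    qed
    have cf: "conjugate (of_real s + of_real t * j) = of_real s - of_real t * j" for s t
      by (simp add: conjugate_dist_add conjugate_dist_mul conj_real cj)
    have nf: "norm (of_real s + of_real t * j) = sqrt (s\<^sup>2 + t\<^sup>2)" for s t
    proof -
      have "(of_real ((norm (of_real s + of_real t * j))\<^sup>2) :: 'k)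
          = of_real s * of_real s - of_real t * of_real t * (j * j)"
        unfolding mult_conjugate[symmetric] cf by (simp add: algebra_simps)
      also have "\<dots> = of_real (s\<^sup>2 + t\<^sup>2)" by (simp add: jj power2_eq_square)
      finally have "(norm (of_real s + of_real t * j))\<^sup>2 = s\<^sup>2 + t\<^sup>2"
        using of_real_eq_iff by blast
      then show ?thesis by (metis norm_ge_zero real_sqrt_unique)
    qed
    show thesis using complex jj dec cf nf by blast
  qed
qed

text \<open>\<open>ip x x\<close> is a nonnegative element of the scalar field, so its \<^const>\<open>norm\<close> is \<open>ip x x\<close> as a real.\<close>

definition hnorm :: "('a \<Rightarrow> 'a \<Rightarrow> 'k::real_or_complex) \<Rightarrow> 'a \<Rightarrow> real" where
  "hnorm ip x = sqrt (norm (ip x x))"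

text \<open>
  A Hilbert space is carried by a subspace \<open>V\<close> of an ambient vector space, which may be \<open>V\<close> itself;
  \<open>ip\<close> is only constrained on \<open>V\<close>.
\<close>

locale hilbert_space = vector_space scl
  for scl :: "'k::real_or_complex \<Rightarrow> 'a::ab_group_add \<Rightarrow> 'a" +
  fixes V :: "'a set" and ip :: "'a \<Rightarrow> 'a \<Rightarrow> 'k"
  assumes subspace_carrier: "subspace V"
    and ip_add_left: "\<lbrakk>x \<in> V; y \<in> V; z \<in> V\<rbrakk> \<Longrightarrow> ip (x + y) z = ip x z + ip y z"
    and ip_scale_left: "\<lbrakk>x \<in> V; y \<in> V\<rbrakk> \<Longrightarrow> ip (scl c x) y = c * ip x y"
    and ip_commute: "\<lbrakk>x \<in> V; y \<in> V\<rbrakk> \<Longrightarrow> ip y x = conjugate (ip x y)"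
    and ip_self_nonneg: "x \<in> V \<Longrightarrow> \<exists>t\<ge>0. ip x x = of_real t"
    and ip_self_eq_0: "\<lbrakk>x \<in> V; ip x x = 0\<rbrakk> \<Longrightarrow> x = 0"
    and complete: "\<lbrakk>\<And>n. X n \<in> V;
        \<And>\<epsilon>. \<epsilon> > 0 \<Longrightarrow> \<exists>N. \<forall>m\<ge>N. \<forall>n\<ge>N. hnorm ip (X m - X n) < \<epsilon>\<rbrakk>
      \<Longrightarrow> \<exists>l\<in>V. (\<lambda>n. hnorm ip (X n - l)) \<longlonglongrightarrow> 0"

definition infinite_dimensional ::
    "('k::field \<Rightarrow> 'a::ab_group_add \<Rightarrow> 'a) \<Rightarrow> 'a set \<Rightarrow> bool" where
  "infinite_dimensional scl V \<longleftrightarrow> \<not> (\<exists>B. finite B \<and> B \<subseteq> V \<and> V \<subseteq> module.span scl B)"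

definition orthonormal_family ::
    "'a set \<Rightarrow> ('a \<Rightarrow> 'a \<Rightarrow> 'k::real_or_complex) \<Rightarrow> (nat \<Rightarrow> 'a) \<Rightarrow> bool" where
  "orthonormal_family V ip e \<longleftrightarrow>
     (\<forall>i. e i \<in> V) \<and> (\<forall>i j. i \<noteq> j \<longrightarrow> ip (e i) (e j) = 0) \<and> (\<forall>i. hnorm ip (e i) = 1)"

definition ell2 :: "(nat \<Rightarrow> 'k::real_normed_field) set" where
  "ell2 = {a. summable (\<lambda>i. (norm (a i))\<^sup>2)}"

text \<open>The sum in \<open>V\<close> of a series that converges in the norm of \<open>V\<close>; cf.\ \<^const>\<open>suminf\<close>.\<close>

definition hsuminf ::
    "'a::ab_group_add set \<Rightarrow> ('a \<Rightarrow> 'a \<Rightarrow> 'k::real_or_complex) \<Rightarrow> (nat \<Rightarrow> 'a) \<Rightarrow> 'a" where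
  "hsuminf V ip f = (THE s. s \<in> V \<and> (\<lambda>n. hnorm ip ((\<Sum>i<n. f i) - s)) \<longlonglongrightarrow> 0)"

end

theory Submission
  imports Defs
begin

text \<open>
  Put \<open>c\<^sub>i = \<langle>x, e\<^sub>i\<rangle>\<close>. Expanding, \<open>\<parallel>x - \<Sum>\<^sub>i\<^sub><\<^sub>n \<lambda>\<^sub>i e\<^sub>i\<parallel>\<^sup>2 = \<parallel>x\<parallel>\<^sup>2 - C\<^sup>2 + D\<^sup>2\<close>, where \<open>A\<close>, \<open>C\<close>, \<open>D\<close> are the Euclidean
  norms of the first \<open>n\<close> entries of \<open>\<lambda>\<close>, \<open>c\<close>, \<open>c - \<lambda>\<close>. Since \<open>D \<ge> \<bar>C - A\<bar>\<close>, the right-hand side is at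
  least \<open>\<parallel>x\<parallel>\<^sup>2 + A\<^sup>2 - 2 A C \<ge> 2 A (\<parallel>x\<parallel> - C)\<close>; now let \<open>n\<close> tend to infinity. The constant is
  optimal already in \<open>\<ell>\<^sup>2\<close>: let \<open>(e\<^sub>i)\<close> be the unit vectors except the first one \<open>u\<close>, let the series be
  \<open>e\<^sub>0\<close>, and \<open>x = e\<^sub>0 + r u\<close>. Then the difference is \<open>sqrt (1 + r\<^sup>2) - 1\<close>, which is asymptotic to
  \<open>r\<^sup>2 / 2\<close> as \<open>r\<close> tends to 0.
\<close>

section \<open>Conjugation and completeness of the scalars\<close>

text \<open>The class ties conjugation to the norm only through the product
  \<open>a * conjugate a\<close>. For a nonzero real scalar this product is \<open>s * s\<close>,
  and one factor can be cancelled.\<close>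

lemma conjugate_of_real [simp]: "conjugate (of_real s :: 'k::real_or_complex) = of_real s"
proof (cases "s = 0")
  case False
  have "(of_real s :: 'k) * conjugate (of_real s) = of_real s * of_real s"
    by (simp add: mult_conjugate power2_eq_square)
  then show ?thesis using False by simp
qed simp

lemma norm_conjugate [simp]: "norm (conjugate a) = norm a" for a :: "'k::real_or_complex"
proof (cases "a = 0")
  case False
  have "norm (a * conjugate a) = norm a * norm a"
    by (simp add: mult_conjugate power2_eq_square norm_mult)
  then show ?thesis using False by (simp add: norm_mult)
qed simp

lemma conjugate_diff: "conjugate (a - b) = conjugate a - conjugate b"
  for a :: "'k::real_or_complex"
  using conjugate_dist_add[of a "- b"] by (simp add: conjugate_neg)

text \<open>Continuity lets conjugation pass through an infinite sum, which yields conjugate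
  symmetry of the inner product on \<open>ell2\<close>.\<close>

lemma bounded_linear_conjugate:
  "bounded_linear (conjugate :: 'k \<Rightarrow> 'k::real_or_complex)"
  by (rule bounded_linear_intro[where K = 1])
    (simp_all add: conjugate_dist_add conjugate_dist_mul scaleR_conv_of_real)

text \<open>The class does not postulate completeness of the scalars, but series in them must converge.\<close>

instance real_or_complex \<subseteq> banach
proof
  fix X :: "nat \<Rightarrow> 'k::real_or_complex"
  assume X: "Cauchy X"
  show "convergent X"
  proof (cases rule: real_or_complex_cases[where ?'k = 'k])
    case real
    define s where "s n = (SOME t. X n = of_real t)" for n
    have s: "X n = of_real (s n)" for n
      unfolding s_def using real(1)[of "X n"] by (auto elim!: Reals_cases intro: someI)
    have "Cauchy s"
      using X by (simp add: Cauchy_def dist_norm s flip: of_real_diff)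
    then have "convergent (\<lambda>n. of_real (s n) :: 'k)"
      using convergent_of_real Cauchy_convergent by blast
    then show ?thesis using s by presburger
  next
    case (complex j)
    have "\<forall>n. \<exists>st. X n = of_real (fst st) + of_real (snd st) * j"
      using complex(2) by simp
    then obtain st where st: "\<And>n. X n = of_real (fst (st n)) + of_real (snd (st n)) * j"
      unfolding choice_iff by blast
    define s t where "s n = fst (st n)" and "t n = snd (st n)" for n
    have X_eq: "X n = of_real (s n) + of_real (t n) * j" for n
      by (simp add: s_def t_def st)
    have norm_eq: "norm (X m - X n) = sqrt ((s m - s n)\<^sup>2 + (t m - t n)\<^sup>2)" for m n
      using complex(4)[of "s m - s n" "t m - t n"] by (simp add: X_eq algebra_simps)
    \<comment> \<open>Both coordinates are dominated by the norm, so they inherit the Cauchy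
      property and completeness of the reals applies to each.\<close>
    have "\<bar>s m - s n\<bar> \<le> norm (X m - X n)" "\<bar>t m - t n\<bar> \<le> norm (X m - X n)" for m n
      unfolding norm_eq by (simp_all add: real_le_rsqrt)
    then have "Cauchy s" "Cauchy t"
      using X unfolding Cauchy_def dist_norm real_norm_def by (meson le_less_trans)+
    then have "convergent (\<lambda>n. of_real (s n) :: 'k)" "convergent (\<lambda>n. of_real (t n) :: 'k)"
      using convergent_of_real Cauchy_convergent by blast+
    then have "convergent (\<lambda>n. of_real (s n) + of_real (t n) * j)"
      by (intro convergent_add convergent_mult convergent_const)
    then show ?thesis using X_eq by presburger
  qed
qed

section \<open>Inner product geometry on the carrier\<close>

context hilbert_space
begin

lemma carrier_add: "x \<in> V \<Longrightarrow> y \<in> V \<Longrightarrow> x + y \<in> V"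
  and carrier_diff: "x \<in> V \<Longrightarrow> y \<in> V \<Longrightarrow> x - y \<in> V"
  and carrier_scale: "x \<in> V \<Longrightarrow> scl c x \<in> V"
  and carrier_zero: "0 \<in> V"
  and carrier_sum: "(\<And>i. i \<in> F \<Longrightarrow> f i \<in> V) \<Longrightarrow> sum f F \<in> V"
  using subspace_carrier
  by (auto intro: subspace_add subspace_diff subspace_scale subspace_0 subspace_sum)

lemma ip_zero_left: "y \<in> V \<Longrightarrow> ip 0 y = 0"
  using ip_add_left[of 0 0 y] carrier_zero by simp

lemma ip_diff_left:
  assumes "x \<in> V" "y \<in> V" "z \<in> V"
  shows "ip (x - y) z = ip x z - ip y z"
  using ip_add_left[of "x - y" y z] assms carrier_diff by simp

lemma ip_add_right:
  assumes "x \<in> V" "y \<in> V" "z \<in> V"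
  shows "ip z (x + y) = ip z x + ip z y"
  using assms carrier_add
  by (metis ip_add_left ip_commute conjugate_dist_add)

lemma ip_diff_right:
  assumes "x \<in> V" "y \<in> V" "z \<in> V"
  shows "ip z (x - y) = ip z x - ip z y"
  using assms carrier_diff
  by (metis ip_diff_left ip_commute conjugate_diff)

lemma ip_scale_right:
  assumes "x \<in> V" "y \<in> V"
  shows "ip x (scl c y) = conjugate c * ip x y"
  using assms carrier_scale
  by (metis ip_scale_left ip_commute conjugate_dist_mul)

lemma ip_sum_left:
  assumes "\<And>i. i \<in> F \<Longrightarrow> f i \<in> V" "y \<in> V"
  shows "ip (sum f F) y = (\<Sum>i\<in>F. ip (f i) y)"
  using assms(1)
  by (induction F rule: infinite_finite_induct)
    (simp_all add: ip_zero_left ip_add_left carrier_sum assms(2))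

lemma hnorm_nonneg [simp]: "0 \<le> hnorm ip x"
  by (simp add: hnorm_def)

lemma ip_self: "x \<in> V \<Longrightarrow> ip x x = of_real ((hnorm ip x)\<^sup>2)"
  using ip_self_nonneg[of x] by (auto simp: hnorm_def)

lemma hnorm_eq_0: "x \<in> V \<Longrightarrow> hnorm ip x = 0 \<Longrightarrow> x = 0"
  by (rule ip_self_eq_0) (simp_all add: ip_self)

lemma hnorm_zero [simp]: "hnorm ip 0 = 0"
  using ip_zero_left[OF carrier_zero] by (simp add: hnorm_def)

lemma hnorm_scale: "x \<in> V \<Longrightarrow> hnorm ip (scl c x) = norm c * hnorm ip x"
  by (simp add: hnorm_def ip_scale_left ip_scale_right carrier_scale norm_mult real_sqrt_mult)

lemma hnorm_minus: "x \<in> V \<Longrightarrow> hnorm ip (- x) = hnorm ip x"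
  using hnorm_scale[of x "- 1"] by (simp add: scale_minus_left)

lemma hnorm_minus_commute: "x \<in> V \<Longrightarrow> y \<in> V \<Longrightarrow> hnorm ip (x - y) = hnorm ip (y - x)"
  using hnorm_minus[of "x - y"] carrier_diff by simp

text \<open>Completing the square in the coefficient \<open>a\<close>: the cross terms are absorbed
  into \<open>norm (ip x u - a)\<close>, so no real parts have to be mentioned. Cauchy-Schwarz,
  Pythagoras and Bessel all come from this identity.\<close>

lemma hnorm_diff_unit_sq:
  assumes x: "x \<in> V" and u: "u \<in> V" "hnorm ip u = 1"
  shows "(hnorm ip (x - scl a u))\<^sup>2 = (hnorm ip x)\<^sup>2 + ((norm (ip x u - a))\<^sup>2 - (norm (ip x u))\<^sup>2)"
proof -
  have uu: "ip u u = 1" using u by (simp add: ip_self)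
  \<comment> \<open>The identity is checked in the scalar field, where every square is a product
    \<open>z * conjugate z\<close> or a value \<open>ip z z\<close> and sesquilinearity applies;
    injectivity of \<open>of_real\<close> brings it back to the reals.\<close>
  have "(of_real ((hnorm ip (x - scl a u))\<^sup>2) :: 'k)
      = of_real ((hnorm ip x)\<^sup>2 + ((norm (ip x u - a))\<^sup>2 - (norm (ip x u))\<^sup>2))"
    unfolding of_real_add of_real_diff mult_conjugate[symmetric]
      ip_self[symmetric, OF x] ip_self[symmetric, OF carrier_diff[OF x carrier_scale[OF u(1)]]]
    using x u(1) ip_commute[OF x u(1)]
    by (simp add: ip_diff_left ip_diff_right ip_scale_left ip_scale_right carrier_diff
        carrier_scale conjugate_diff uu algebra_simps)
  then show ?thesis using of_real_eq_iff by blast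
qed

text \<open>Cauchy-Schwarz: normalise \<open>y\<close> to a unit vector \<open>u\<close>; removing
  from \<open>x\<close> its component along \<open>u\<close> leaves a vector whose squared norm,
  \<open>(hnorm ip x)^2 - (norm (ip x u))^2\<close>, cannot be negative.\<close>

lemma norm_ip_le:
  assumes x: "x \<in> V" and y: "y \<in> V"
  shows "norm (ip x y) \<le> hnorm ip x * hnorm ip y"
proof (cases "y = 0")
  case True
  then show ?thesis using ip_commute[OF y x] ip_zero_left[OF x] by simp
next
  case False
  define t where "t = hnorm ip y"
  have t: "t > 0" using False hnorm_eq_0[OF y] hnorm_nonneg[of y] by (force simp: t_def less_le)
  define u where "u = scl (of_real (1 / t)) y"
  have u: "u \<in> V" "hnorm ip u = 1"
    using t y by (auto simp: u_def carrier_scale hnorm_scale norm_divide simp flip: t_def)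
  have "(norm (ip x u))\<^sup>2 \<le> (hnorm ip x)\<^sup>2"
    using hnorm_diff_unit_sq[OF x u, of "ip x u"] zero_le_power2[of "hnorm ip (x - scl (ip x u) u)"]
    by simp
  then have "norm (ip x u) \<le> hnorm ip x" by (simp add: power2_le_iff_abs_le)
  moreover have "norm (ip x u) = norm (ip x y) / t"
    using t by (simp add: u_def ip_scale_right x y norm_mult norm_divide del: of_real_divide)
  ultimately show ?thesis using t by (simp add: field_simps t_def)
qed

lemma hnorm_triangle:
  assumes x: "x \<in> V" and y: "y \<in> V"
  shows "hnorm ip (x + y) \<le> hnorm ip x + hnorm ip y"
proof (rule power2_le_imp_le)
  have "(hnorm ip (x + y))\<^sup>2 = norm (ip (x + y) (x + y))"
    by (simp add: hnorm_def)
  also have "ip (x + y) (x + y) = ip x x + ip x y + (ip y x + ip y y)"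
    using x y by (simp add: ip_add_left ip_add_right carrier_add)
  also have "norm \<dots> \<le> norm (ip x x) + norm (ip x y) + (norm (ip y x) + norm (ip y y))"
    by (intro norm_triangle_le add_mono order_refl norm_triangle_ineq)
  also have "\<dots> \<le> (hnorm ip x + hnorm ip y)\<^sup>2"
    using norm_ip_le[OF x y] norm_ip_le[OF y x]
    by (simp add: ip_self x y power2_sum mult.commute[of "hnorm ip y"] mult.assoc
        del: of_real_power)
  finally show "(hnorm ip (x + y))\<^sup>2 \<le> (hnorm ip x + hnorm ip y)\<^sup>2" .
qed simp

section \<open>Orthogonal series and Bessel's inequality\<close>

text \<open>\<open>hsuminf\<close> is a definite description, so a limit must be shown unique before
  it can be identified: two limits are both close to the same partial sums, hence at distance
  0.\<close>

lemma hsuminf_eqI: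
  assumes f: "\<And>i. f i \<in> V" and s: "s \<in> V"
    and lim: "(\<lambda>n. hnorm ip ((\<Sum>i<n. f i) - s)) \<longlonglongrightarrow> 0"
  shows "hsuminf V ip f = s"
  unfolding hsuminf_def
proof (rule the_equality)
  fix s'
  assume s': "s' \<in> V \<and> (\<lambda>n. hnorm ip ((\<Sum>i<n. f i) - s')) \<longlonglongrightarrow> 0"
  have "hnorm ip (s' - s) \<le> hnorm ip ((\<Sum>i<n. f i) - s) + hnorm ip ((\<Sum>i<n. f i) - s')" for n
  proof -
    let ?p = "\<Sum>i<n. f i"
    have p: "?p \<in> V" using f by (rule carrier_sum)
    have "hnorm ip (s' - s) = hnorm ip ((?p - s) + (s' - ?p))" by simp
    also have "\<dots> \<le> hnorm ip (?p - s) + hnorm ip (s' - ?p)"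
      by (intro hnorm_triangle carrier_diff p s s'[THEN conjunct1])
    finally show ?thesis using hnorm_minus_commute[OF p, of s'] s' by simp
  qed
  moreover have "(\<lambda>n. hnorm ip ((\<Sum>i<n. f i) - s) + hnorm ip ((\<Sum>i<n. f i) - s')) \<longlonglongrightarrow> 0 + 0"
    using lim s' by (intro tendsto_add) auto
  ultimately have "hnorm ip (s' - s) \<le> 0"
    by (intro LIMSEQ_le_const) auto
  then have "hnorm ip (s' - s) = 0" using hnorm_nonneg[of "s' - s"] by linarith
  then show "s' = s" using hnorm_eq_0 carrier_diff s s' by (metis eq_iff_diff_eq_0)
qed (use s lim in blast)

text \<open>The terms are subtracted one at a time. By orthogonality, the terms already removed do
  not change the coefficient against the next \<open>e k\<close>, so
  \<open>hnorm_diff_unit_sq\<close> applies with the original \<open>ip x (e k)\<close>. Taking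
  \<open>x = 0\<close> gives Pythagoras; taking the coefficients of \<open>x\<close> for
  \<open>a\<close> gives Bessel.\<close>

lemma hnorm_diff_sum_sq:
  assumes e: "orthonormal_family V ip e" and x: "x \<in> V" and F: "finite F"
  shows "(hnorm ip (x - (\<Sum>i\<in>F. scl (a i) (e i))))\<^sup>2
    = (hnorm ip x)\<^sup>2 + (\<Sum>i\<in>F. (norm (ip x (e i) - a i))\<^sup>2 - (norm (ip x (e i)))\<^sup>2)"
  using F
proof (induction F rule: finite_induct)
  case (insert k F)
  have eV: "e i \<in> V" for i using e by (simp add: orthonormal_family_def)
  let ?p = "\<Sum>i\<in>F. scl (a i) (e i)"
  have p: "?p \<in> V" by (intro carrier_sum carrier_scale eV)
  have "ip ?p (e k) = (\<Sum>i\<in>F. a i * ip (e i) (e k))"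
    by (simp add: ip_sum_left carrier_scale eV ip_scale_left)
  also have "\<dots> = 0"
    using insert.hyps(2) e by (intro sum.neutral) (simp, metis orthonormal_family_def)
  finally have "ip (x - ?p) (e k) = ip x (e k)" by (simp add: ip_diff_left x p eV)
  moreover have split: "x - (\<Sum>i\<in>insert k F. scl (a i) (e i)) = (x - ?p) - scl (a k) (e k)"
    using insert.hyps by (simp add: algebra_simps)
  moreover have "hnorm ip (e k) = 1" using e by (simp add: orthonormal_family_def)
  ultimately show ?case
    using hnorm_diff_unit_sq[OF carrier_diff[OF x p] eV, of k "a k"] insert
    unfolding split by simp
qed simp

lemma hnorm_sum_sq:
  assumes e: "orthonormal_family V ip e" and F: "finite F"
  shows "(hnorm ip (\<Sum>i\<in>F. scl (a i) (e i)))\<^sup>2 = (\<Sum>i\<in>F. (norm (a i))\<^sup>2)"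
proof -
  have eV: "e i \<in> V" for i using e by (simp add: orthonormal_family_def)
  then show ?thesis
    using hnorm_diff_sum_sq[OF e carrier_zero F, of a]
    by (simp add: ip_zero_left hnorm_minus carrier_sum carrier_scale)
qed

lemma bessel:
  assumes e: "orthonormal_family V ip e" and x: "x \<in> V" and F: "finite F"
  shows "(\<Sum>i\<in>F. (norm (ip x (e i)))\<^sup>2) \<le> (hnorm ip x)\<^sup>2"
  using hnorm_diff_sum_sq[OF e x F, of "\<lambda>i. ip x (e i)"]
    zero_le_power2[of "hnorm ip (x - (\<Sum>i\<in>F. scl (ip x (e i)) (e i)))"]
  by (simp add: sum_negf)

text \<open>By Pythagoras, the distance between two partial sums is the root of a block of the
  convergent series of squares. The partial sums are therefore Cauchy, and completeness supplies the
  limit.\<close>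

lemma hsuminf_ell2:
  assumes e: "orthonormal_family V ip e" and a: "a \<in> ell2"
  shows "hsuminf V ip (\<lambda>i. scl (a i) (e i)) \<in> V"
    and "(\<lambda>n. hnorm ip ((\<Sum>i<n. scl (a i) (e i)) - hsuminf V ip (\<lambda>i. scl (a i) (e i)))) \<longlonglongrightarrow> 0"
proof -
  have eV: "e i \<in> V" for i using e by (simp add: orthonormal_family_def)
  define p where "p n = (\<Sum>i<n. scl (a i) (e i))" for n
  have p: "p n \<in> V" for n unfolding p_def by (intro carrier_sum carrier_scale eV)
  have dist: "hnorm ip (p n - p m) = sqrt (\<Sum>i=m..<n. (norm (a i))\<^sup>2)" if "m \<le> n" for m n
  proof -
    have "p n - p m = (\<Sum>i=m..<n. scl (a i) (e i))"
      using that by (simp add: p_def sum_diff_nat_ivl lessThan_atLeast0)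
    then show ?thesis
      using hnorm_sum_sq[OF e, of "{m..<n}" a] by (simp add: real_sqrt_unique)
  qed
  have "\<exists>l\<in>V. (\<lambda>n. hnorm ip (p n - l)) \<longlonglongrightarrow> 0"
  proof (rule complete[OF p])
    fix \<epsilon> :: real
    assume \<epsilon>: "\<epsilon> > 0"
    have "summable (\<lambda>i. (norm (a i))\<^sup>2)" using a by (simp add: ell2_def)
    then obtain N where "\<forall>m\<ge>N. \<forall>n. norm (\<Sum>i=m..<n. (norm (a i))\<^sup>2) < \<epsilon>\<^sup>2"
      using \<epsilon> unfolding summable_Cauchy by (metis zero_less_power)
    then have N: "norm (\<Sum>i=m..<n. (norm (a i))\<^sup>2) < \<epsilon>\<^sup>2" if "m \<ge> N" for m n
      using that by blast
    have close: "hnorm ip (p n - p m) < \<epsilon>" if "N \<le> m" "m \<le> n" for m n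
      using N[OF that(1), of n] \<epsilon> by (auto simp: dist[OF that(2)] intro!: real_less_lsqrt)
    have "hnorm ip (p m - p n) < \<epsilon>" if "m \<ge> N" "n \<ge> N" for m n
      using close[of m n] close[of n m] that hnorm_minus_commute[OF p p] by (metis nle_le)
    then show "\<exists>N. \<forall>m\<ge>N. \<forall>n\<ge>N. hnorm ip (p m - p n) < \<epsilon>" by blast
  qed
  then obtain l where l: "l \<in> V" "(\<lambda>n. hnorm ip (p n - l)) \<longlonglongrightarrow> 0" by blast
  have "hsuminf V ip (\<lambda>i. scl (a i) (e i)) = l"
    using l by (intro hsuminf_eqI carrier_scale eV) (simp_all add: p_def)
  with l show "hsuminf V ip (\<lambda>i. scl (a i) (e i)) \<in> V"
    "(\<lambda>n. hnorm ip ((\<Sum>i<n. scl (a i) (e i)) - hsuminf V ip (\<lambda>i. scl (a i) (e i)))) \<longlonglongrightarrow> 0"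
    by (simp_all add: p_def)
qed

lemma bessel_summable:
  assumes "orthonormal_family V ip e" "x \<in> V"
  shows "summable (\<lambda>i. (norm (ip x (e i)))\<^sup>2)"
    and "sqrt (\<Sum>i. (norm (ip x (e i)))\<^sup>2) \<le> hnorm ip x"
proof -
  show s: "summable (\<lambda>i. (norm (ip x (e i)))\<^sup>2)"
    by (rule summableI_nonneg_bounded[where x = "(hnorm ip x)\<^sup>2"]) (simp_all add: bessel assms)
  have "(\<Sum>i. (norm (ip x (e i)))\<^sup>2) \<le> (hnorm ip x)\<^sup>2"
    by (rule suminf_le_const[OF s]) (simp add: bessel assms)
  then show "sqrt (\<Sum>i. (norm (ip x (e i)))\<^sup>2) \<le> hnorm ip x"
    by (rule real_le_lsqrt[OF hnorm_nonneg])
qed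

section \<open>The upper bound\<close>

text \<open>The bound for finitely many terms of the series, but already with the full coefficient
  sum of \<open>x\<close>, so that on the left only the norm of the truncated \<open>a\<close>
  depends on \<open>n\<close>.\<close>

lemma hnorm_diff_partial_sum_ge:
  assumes e: "orthonormal_family V ip e" and x: "x \<in> V"
  shows "2 * L2_set (\<lambda>i. norm (a i)) {..<n}
      * (hnorm ip x - sqrt (\<Sum>i. (norm (ip x (e i)))\<^sup>2))
    \<le> (hnorm ip (x - (\<Sum>i<n. scl (a i) (e i))))\<^sup>2"
proof -
  define c where "c i = ip x (e i)" for i
  define A where "A = L2_set (\<lambda>i. norm (a i)) {..<n}"
  define C where "C = L2_set (\<lambda>i. norm (c i)) {..<n}"
  define D where "D = L2_set (\<lambda>i. norm (c i - a i)) {..<n}"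
  define S where "S = sqrt (\<Sum>i. (norm (c i))\<^sup>2)"
  have nonneg: "A \<ge> 0" "C \<ge> 0" "D \<ge> 0" by (simp_all add: A_def C_def D_def)
  have triangle: "L2_set (\<lambda>i. norm (f i)) {..<n}
      \<le> L2_set (\<lambda>i. norm (g i)) {..<n} + L2_set (\<lambda>i. norm (f i - g i)) {..<n}"
    for f g :: "nat \<Rightarrow> 'k"
  proof -
    have "L2_set (\<lambda>i. norm (f i)) {..<n} \<le> L2_set (\<lambda>i. norm (g i) + norm (f i - g i)) {..<n}"
      by (intro L2_set_mono) (simp_all add: norm_triangle_sub)
    then show ?thesis by (rule order_trans[OF _ L2_set_triangle_ineq])
  qed
  have "\<bar>C - A\<bar> \<le> D"
    using triangle[of c a] triangle[of a c]
    by (simp add: A_def C_def D_def norm_minus_commute abs_le_iff)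
  then have D: "(C - A)\<^sup>2 \<le> D\<^sup>2" using abs_le_square_iff[of "C - A" D] nonneg by simp
  have CS: "C \<le> S"
    unfolding C_def S_def L2_set_def
    using bessel_summable(1)[OF e x] by (intro real_sqrt_le_mono sum_le_suminf) (simp_all add: c_def)
  have "2 * A * (hnorm ip x - S) \<le> 2 * A * (hnorm ip x - C)"
    using CS nonneg by (intro mult_left_mono) auto
  \<comment> \<open>The two sides differ by exactly \<open>(hnorm ip x - A)^2\<close>.\<close>
  also have "\<dots> \<le> (hnorm ip x)\<^sup>2 - C\<^sup>2 + (C - A)\<^sup>2"
    using zero_le_power2[of "hnorm ip x - A"] by (simp add: power2_eq_square algebra_simps)
  also have "\<dots> \<le> (hnorm ip x)\<^sup>2 - C\<^sup>2 + D\<^sup>2" using D by simp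
  also have "\<dots> = (hnorm ip (x - (\<Sum>i<n. scl (a i) (e i))))\<^sup>2"
    using hnorm_diff_sum_sq[OF e x, of "{..<n}" a]
    by (simp add: C_def D_def L2_set_def c_def sum_nonneg sum_subtractf)
  finally show ?thesis by (simp add: A_def S_def c_def)
qed

lemma hnorm_diff_hsuminf_ge:
  assumes e: "orthonormal_family V ip e" and a: "a \<in> ell2" and x: "x \<in> V"
  shows "2 * sqrt (\<Sum>i. (norm (a i))\<^sup>2) * (hnorm ip x - sqrt (\<Sum>i. (norm (ip x (e i)))\<^sup>2))
    \<le> (hnorm ip (x - hsuminf V ip (\<lambda>i. scl (a i) (e i))))\<^sup>2"
proof (rule LIMSEQ_le)
  have eV: "e i \<in> V" for i using e by (simp add: orthonormal_family_def)
  let ?p = "\<lambda>n. \<Sum>i<n. scl (a i) (e i)"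
  let ?y = "hsuminf V ip (\<lambda>i. scl (a i) (e i))"
  have y: "?y \<in> V" and lim: "(\<lambda>n. hnorm ip (?p n - ?y)) \<longlonglongrightarrow> 0"
    using hsuminf_ell2[OF e a] by auto
  have p: "?p n \<in> V" for n by (intro carrier_sum carrier_scale eV)
  show "(\<lambda>n. 2 * L2_set (\<lambda>i. norm (a i)) {..<n}
      * (hnorm ip x - sqrt (\<Sum>i. (norm (ip x (e i)))\<^sup>2)))
    \<longlonglongrightarrow> 2 * sqrt (\<Sum>i. (norm (a i))\<^sup>2) * (hnorm ip x - sqrt (\<Sum>i. (norm (ip x (e i)))\<^sup>2))"
    unfolding L2_set_def using a by (intro tendsto_intros summable_LIMSEQ) (simp add: ell2_def)
  \<comment> \<open>Instead of the convergence of \<open>hnorm ip (x - ?p n)\<close>, a majorant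
    given by the triangle inequality is used, which visibly has the required limit.\<close>
  show "(\<lambda>n. (hnorm ip (x - ?y) + hnorm ip (?p n - ?y))\<^sup>2) \<longlonglongrightarrow> (hnorm ip (x - ?y))\<^sup>2"
    using tendsto_power[OF tendsto_add[OF tendsto_const lim], of "hnorm ip (x - ?y)" 2] by simp
  have "hnorm ip (x - ?p n) \<le> hnorm ip (x - ?y) + hnorm ip (?p n - ?y)" for n
    using hnorm_triangle[OF carrier_diff[OF x y] carrier_diff[OF y p[of n]]]
      hnorm_minus_commute[OF y p[of n]] by simp
  then have "(hnorm ip (x - ?p n))\<^sup>2 \<le> (hnorm ip (x - ?y) + hnorm ip (?p n - ?y))\<^sup>2" for n
    by (intro power_mono) simp_all
  then show "\<exists>N. \<forall>n\<ge>N. 2 * L2_set (\<lambda>i. norm (a i)) {..<n}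
      * (hnorm ip x - sqrt (\<Sum>i. (norm (ip x (e i)))\<^sup>2))
    \<le> (hnorm ip (x - ?y) + hnorm ip (?p n - ?y))\<^sup>2"
    using order_trans[OF hnorm_diff_partial_sum_ge[OF e x]] by blast
qed

text \<open>Pairing a vanishing linear combination with one of its vectors isolates that
  coefficient, so the family is independent; a finite spanning set would bound its size. This
  supplies infinite dimension for the extremal example.\<close>

lemma orthonormal_family_imp_infinite_dimensional:
  assumes e: "orthonormal_family V ip e"
  shows "infinite_dimensional scl V"
proof -
  have eV: "e i \<in> V" and ee: "ip (e i) (e i) = 1" and orth: "i \<noteq> j \<Longrightarrow> ip (e i) (e j) = 0" for i j
    using e by (simp_all add: orthonormal_family_def ip_self)
  have "inj e" by (rule injI) (metis ee orth zero_neq_one)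
  have "independent (range e)"
    unfolding independent_explicit_module
  proof (intro allI impI)
    fix T u v
    assume T: "finite T" "T \<subseteq> range e" "(\<Sum>w\<in>T. scl (u w) w) = 0" "v \<in> T"
    have TV: "w \<in> V" if "w \<in> T" for w using that T(2) eV by blast
    have "0 = ip (\<Sum>w\<in>T. scl (u w) w) v" using T TV by (simp add: ip_zero_left)
    also have "\<dots> = (\<Sum>w\<in>T. u w * ip w v)"
      using T(4) TV by (simp add: ip_sum_left carrier_scale ip_scale_left)
    also have "\<dots> = (\<Sum>w\<in>T. if w = v then u v else 0)"
    proof (rule sum.cong)
      fix w
      assume "w \<in> T"
      then obtain i j where "w = e i" "v = e j" using T by blast
      then show "u w * ip w v = (if w = v then u v else 0)"
        by (cases "i = j") (simp_all add: ee orth inj_eq \<open>inj e\<close>)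
    qed simp
    also have "\<dots> = u v" using T by simp
    finally show "u v = 0" by simp
  qed
  moreover have "infinite (range e)" using \<open>inj e\<close> finite_imageD by blast
  moreover have "range e \<subseteq> V" using eV by blast
  ultimately have "\<not> V \<subseteq> span B" if "finite B" for B
    using independent_span_bound[OF that, of "range e"] subset_trans[of "range e" V] by blast
  then show ?thesis unfolding infinite_dimensional_def by blast
qed

end

section \<open>The Hilbert space of square-summable sequences\<close>

definition ell2_ip :: "(nat \<Rightarrow> 'k) \<Rightarrow> (nat \<Rightarrow> 'k) \<Rightarrow> 'k::real_or_complex" where
  "ell2_ip a b = (\<Sum>i. a i * conjugate (b i))"

text \<open>Absolute convergence follows from
  \<open>norm u * norm v <= (norm u)^2 + (norm v)^2\<close>; completeness of the scalars turns it
  into convergence.\<close>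

lemma ell2_ip_summable:
  fixes a b :: "nat \<Rightarrow> 'k::real_or_complex"
  assumes "a \<in> ell2" "b \<in> ell2"
  shows "summable (\<lambda>i. a i * conjugate (b i))"
proof (rule summable_norm_cancel, rule summable_comparison_test')
  show "summable (\<lambda>i. (norm (a i))\<^sup>2 + (norm (b i))\<^sup>2)"
    using assms by (intro summable_add) (simp_all add: ell2_def)
  have "norm u * norm v \<le> (norm u)\<^sup>2 + (norm v)\<^sup>2" for u v :: 'k
    using sum_squares_bound[of "norm u" "norm v"]
      mult_nonneg_nonneg[OF norm_ge_zero norm_ge_zero, of u v]
    unfolding mult.assoc by linarith
  then show "norm (norm (a i * conjugate (b i))) \<le> (norm (a i))\<^sup>2 + (norm (b i))\<^sup>2" for i
    by (simp add: norm_mult)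
qed

lemma ell2_add:
  fixes a b :: "nat \<Rightarrow> 'k::real_normed_field"
  assumes "a \<in> ell2" "b \<in> ell2"
  shows "a + b \<in> ell2"
  unfolding ell2_def mem_Collect_eq
proof (rule summable_comparison_test')
  show "summable (\<lambda>i. 2 * ((norm (a i))\<^sup>2 + (norm (b i))\<^sup>2))"
    using assms by (intro summable_mult summable_add) (simp_all add: ell2_def)
  show "norm ((norm ((a + b) i))\<^sup>2) \<le> 2 * ((norm (a i))\<^sup>2 + (norm (b i))\<^sup>2)" for i
  proof -
    have "(norm (a i + b i))\<^sup>2 \<le> (norm (a i) + norm (b i))\<^sup>2"
      by (intro power_mono norm_triangle_ineq) simp
    also have "\<dots> \<le> 2 * ((norm (a i))\<^sup>2 + (norm (b i))\<^sup>2)"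
      using sum_squares_bound[of "norm (a i)" "norm (b i)"] by (simp add: power2_sum)
    finally show ?thesis by simp
  qed
qed

lemma ell2_scale: "a \<in> ell2 \<Longrightarrow> (\<lambda>i. c * a i) \<in> ell2"
  by (simp add: ell2_def norm_mult power_mult_distrib summable_mult)

lemma ell2_diff: "a \<in> ell2 \<Longrightarrow> b \<in> ell2 \<Longrightarrow> a - b \<in> ell2"
  using ell2_add[of a "\<lambda>i. - 1 * b i"] ell2_scale[of b "- 1"]
  by (simp add: fun_eq_iff plus_fun_def fun_diff_def)

lemma ell2_finite_support: "finite N \<Longrightarrow> (\<And>i. i \<notin> N \<Longrightarrow> a i = 0) \<Longrightarrow> a \<in> ell2"
  unfolding ell2_def mem_Collect_eq by (rule summable_finite[of N]) auto

lemma ell2_ip_self: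
  fixes a :: "nat \<Rightarrow> 'k::real_or_complex"
  assumes "a \<in> ell2"
  shows "ell2_ip a a = of_real (\<Sum>i. (norm (a i))\<^sup>2)"
  using assms unfolding ell2_ip_def mult_conjugate ell2_def
  by (simp add: suminf_of_real del: of_real_power)

lemma hnorm_ell2_ip:
  fixes a :: "nat \<Rightarrow> 'k::real_or_complex"
  assumes "a \<in> ell2"
  shows "hnorm ell2_ip a = sqrt (\<Sum>i. (norm (a i))\<^sup>2)"
  using assms by (simp add: hnorm_def ell2_ip_self suminf_nonneg ell2_def)

lemma L2_set_le_hnorm_ell2:
  fixes a :: "nat \<Rightarrow> 'k::real_or_complex"
  assumes "a \<in> ell2" "finite F"
  shows "L2_set (\<lambda>i. norm (a i)) F \<le> hnorm ell2_ip a"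
  using assms unfolding hnorm_ell2_ip[OF assms(1)] L2_set_def
  by (intro real_sqrt_le_mono sum_le_suminf) (simp_all add: ell2_def)

lemma norm_le_hnorm_ell2:
  fixes a :: "nat \<Rightarrow> 'k::real_or_complex"
  assumes "a \<in> ell2"
  shows "norm (a i) \<le> hnorm ell2_ip a"
  using L2_set_le_hnorm_ell2[OF assms, of "{i}"] by simp

text \<open>Reduces membership and a norm bound to finite sections, where a bound survives
  coordinatewise limits.\<close>

lemma ell2I_bounded_L2_set:
  fixes a :: "nat \<Rightarrow> 'k::real_or_complex"
  assumes "\<And>n. L2_set (\<lambda>i. norm (a i)) {..<n} \<le> B"
  shows "a \<in> ell2" and "hnorm ell2_ip a \<le> B"
proof -
  have B: "0 \<le> B" using assms[of 0] by simp
  have le: "(\<Sum>i<n. (norm (a i))\<^sup>2) \<le> B\<^sup>2" for n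
    using assms[of n] B by (simp add: L2_set_def real_sqrt_le_iff' sum_nonneg)
  show a: "a \<in> ell2"
    unfolding ell2_def mem_Collect_eq by (rule summableI_nonneg_bounded[OF _ le]) simp
  then have "(\<Sum>i. (norm (a i))\<^sup>2) \<le> B\<^sup>2"
    unfolding ell2_def mem_Collect_eq by (rule suminf_le_const[OF _ le])
  then show "hnorm ell2_ip a \<le> B"
    unfolding hnorm_ell2_ip[OF a] by (rule real_le_lsqrt[OF B])
qed

text \<open>The limit is formed coordinatewise. On each finite section the Cauchy estimate passes to
  the limit in one index, and the resulting bound is uniform in the section.\<close>

lemma ell2_complete:
  fixes X :: "nat \<Rightarrow> nat \<Rightarrow> 'k::real_or_complex"
  assumes X: "\<And>n. X n \<in> ell2"
    and Cauchy: "\<And>\<epsilon>. \<epsilon> > 0 \<Longrightarrow> \<exists>N. \<forall>m\<ge>N. \<forall>n\<ge>N. hnorm ell2_ip (X m - X n) < \<epsilon>"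
  shows "\<exists>l\<in>ell2. (\<lambda>n. hnorm ell2_ip (X n - l)) \<longlonglongrightarrow> 0"
proof -
  have "convergent (\<lambda>n. X n i)" for i
  proof (rule Cauchy_convergent, rule metric_CauchyI)
    fix \<epsilon> :: real
    assume "\<epsilon> > 0"
    then obtain N where N: "\<forall>m\<ge>N. \<forall>n\<ge>N. hnorm ell2_ip (X m - X n) < \<epsilon>" using Cauchy by blast
    have "dist (X m i) (X n i) \<le> hnorm ell2_ip (X m - X n)" for m n
      using norm_le_hnorm_ell2[OF ell2_diff[OF X X], of m n i] by (simp add: dist_norm)
    then show "\<exists>N. \<forall>m\<ge>N. \<forall>n\<ge>N. dist (X m i) (X n i) < \<epsilon>"
      using N le_less_trans by blast
  qed
  then have "\<forall>i. \<exists>L. (\<lambda>n. X n i) \<longlonglongrightarrow> L" by (simp add: convergent_def)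
  then obtain l where l: "\<And>i. (\<lambda>n. X n i) \<longlonglongrightarrow> l i" unfolding choice_iff by blast
  \<comment> \<open>Membership of the difference is part of the claim because \<open>l\<close> is
    not yet known to be in \<open>ell2\<close>; it then follows by writing \<open>l\<close> as
    \<open>X n - (X n - l)\<close>.\<close>
  have close: "\<exists>N. \<forall>n\<ge>N. X n - l \<in> ell2 \<and> hnorm ell2_ip (X n - l) \<le> \<epsilon>"
    if \<epsilon>: "\<epsilon> > 0" for \<epsilon>
  proof -
    obtain N where N: "\<And>m n. m \<ge> N \<Longrightarrow> n \<ge> N \<Longrightarrow> hnorm ell2_ip (X m - X n) < \<epsilon>"
      using Cauchy[OF \<epsilon>] by blast
    have "L2_set (\<lambda>i. norm ((X n - l) i)) {..<k} \<le> \<epsilon>" if "n \<ge> N" for n k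
    proof (rule LIMSEQ_le_const2)
      show "(\<lambda>m. L2_set (\<lambda>i. norm ((X n - X m) i)) {..<k})
          \<longlonglongrightarrow> L2_set (\<lambda>i. norm ((X n - l) i)) {..<k}"
        unfolding L2_set_def fun_diff_def by (intro tendsto_intros l)
      have "L2_set (\<lambda>i. norm ((X n - X m) i)) {..<k} \<le> \<epsilon>" if "m \<ge> N" for m
        using L2_set_le_hnorm_ell2[OF ell2_diff[OF X X], of "{..<k}" n m]
          N[OF \<open>n \<ge> N\<close> that] by simp
      then show "\<exists>M. \<forall>m\<ge>M. L2_set (\<lambda>i. norm ((X n - X m) i)) {..<k} \<le> \<epsilon>" by blast
    qed
    then show ?thesis using ell2I_bounded_L2_set by blast
  qed
  obtain n where "X n - l \<in> ell2" using close[of 1] by auto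
  then have "l \<in> ell2" using ell2_diff[OF X, of "X n - l" n] by simp
  moreover have "(\<lambda>n. hnorm ell2_ip (X n - l)) \<longlonglongrightarrow> 0"
  proof (rule LIMSEQ_I)
    fix \<epsilon> :: real
    assume \<epsilon>: "\<epsilon> > 0"
    obtain N where N: "\<And>n. n \<ge> N \<Longrightarrow> hnorm ell2_ip (X n - l) \<le> \<epsilon> / 2"
      using close[of "\<epsilon> / 2"] \<epsilon> by auto
    have "norm (hnorm ell2_ip (X n - l) - 0) < \<epsilon>" if "n \<ge> N" for n
      using N[OF that] \<epsilon> by (simp add: hnorm_def)
    then show "\<exists>N. \<forall>n\<ge>N. norm (hnorm ell2_ip (X n - l) - 0) < \<epsilon>" by blast
  qed
  ultimately show ?thesis by blast
qed

lemma hilbert_space_ell2: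
  "hilbert_space (\<lambda>(c::'k::real_or_complex) a i. c * a i) ell2 ell2_ip"
proof -
  interpret vector_space "\<lambda>(c::'k) (a::nat \<Rightarrow> 'k) i. c * a i"
    by unfold_locales (auto simp: fun_eq_iff algebra_simps)
  show ?thesis
  proof
    show "subspace (ell2 :: (nat \<Rightarrow> 'k) set)"
      by (rule subspaceI) (simp_all add: ell2_add ell2_scale ell2_finite_support[of "{}"])
  next
    fix x y z :: "nat \<Rightarrow> 'k"
    assume xyz: "x \<in> ell2" "y \<in> ell2" "z \<in> ell2"
    show "ell2_ip (x + y) z = ell2_ip x z + ell2_ip y z"
      unfolding ell2_ip_def
      using suminf_add[OF ell2_ip_summable[OF xyz(1,3)] ell2_ip_summable[OF xyz(2,3)]]
      by (simp add: algebra_simps)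
  next
    fix x y :: "nat \<Rightarrow> 'k" and c
    assume xy: "x \<in> ell2" "y \<in> ell2"
    show "ell2_ip (\<lambda>i. c * x i) y = c * ell2_ip x y"
      unfolding ell2_ip_def using suminf_mult[OF ell2_ip_summable[OF xy], of c]
      by (simp add: mult.assoc)
    show "ell2_ip y x = conjugate (ell2_ip x y)"
      unfolding ell2_ip_def
        bounded_linear.suminf[OF bounded_linear_conjugate ell2_ip_summable[OF xy]]
      by (simp add: conjugate_dist_mul mult.commute)
  next
    fix x :: "nat \<Rightarrow> 'k"
    assume x: "x \<in> ell2"
    then have sum: "summable (\<lambda>i. (norm (x i))\<^sup>2)" by (simp add: ell2_def)
    show "\<exists>t\<ge>0. ell2_ip x x = of_real t"
      using ell2_ip_self[OF x] suminf_nonneg[OF sum] by auto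
    show "x = 0" if "ell2_ip x x = 0"
      using that suminf_eq_zero_iff[OF sum] by (auto simp: ell2_ip_self[OF x] fun_eq_iff)
  qed (fact ell2_complete)
qed

lemma ell2_ip_unit: "ell2_ip x (\<lambda>j. if j = k then 1 else 0) = x k"
  for x :: "nat \<Rightarrow> 'k::real_or_complex"
proof -
  have "ell2_ip x (\<lambda>j. if j = k then 1 else 0)
      = (\<Sum>j\<in>{k}. x j * conjugate (if j = k then 1 else 0))"
    unfolding ell2_ip_def by (rule suminf_finite) auto
  also have "\<dots> = x k" using conjugate_of_real[of 1, where ?'k = 'k] by simp
  finally show ?thesis .
qed

lemma hnorm_ell2_finite_support:
  fixes x :: "nat \<Rightarrow> 'k::real_or_complex"
  assumes "finite N" "\<And>i. i \<notin> N \<Longrightarrow> x i = 0"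
  shows "hnorm ell2_ip x = sqrt (\<Sum>i\<in>N. (norm (x i))\<^sup>2)"
  using hnorm_ell2_ip[OF ell2_finite_support[OF assms]]
    suminf_finite[OF assms(1), of "\<lambda>i. (norm (x i))\<^sup>2"] assms(2) by simp

section \<open>Optimality of the constant\<close>

lemma constant_half_optimal:
  fixes c :: real
  assumes c: "c < 1 / 2"
  shows "\<exists>(scl :: 'k::real_or_complex \<Rightarrow> (nat \<Rightarrow> 'k) \<Rightarrow> (nat \<Rightarrow> 'k)) V ip e lam r x.
    hilbert_space scl V ip \<and> infinite_dimensional scl V \<and> orthonormal_family V ip e \<and>
    lam \<in> ell2 \<and> lam \<noteq> (\<lambda>i. 0) \<and> r > 0 \<and> x \<in> V \<and>
    hnorm ip (x - hsuminf V ip (\<lambda>i. scl (lam i) (e i))) \<le> r \<and>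
    hnorm ip x - sqrt (\<Sum>i. (norm (ip x (e i)))\<^sup>2) > c * (r\<^sup>2 / sqrt (\<Sum>i. (norm (lam i))\<^sup>2))"
proof -
  define scl :: "'k \<Rightarrow> (nat \<Rightarrow> 'k) \<Rightarrow> (nat \<Rightarrow> 'k)" where "scl = (\<lambda>c a i. c * a i)"
  define unit :: "nat \<Rightarrow> nat \<Rightarrow> 'k" where "unit k j = (if j = k then 1 else 0)" for k j
  \<comment> \<open>The shift leaves \<open>unit 0\<close> orthogonal to the whole family, so the
    component of \<open>x\<close> along it adds to the norm but to none of the coefficients.\<close>
  define e where "e i = unit (Suc i)" for i
  \<comment> \<open>The goal becomes \<open>c * t < sqrt (t + 1) - 1\<close> with
    \<open>t = r^2\<close>, for which \<open>(1 + c * t)^2 < t + 1\<close> suffices, whatever the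
    sign of \<open>1 + c * t\<close>. For positive \<open>t\<close> this means
    \<open>c^2 * t < 1 - 2 * c\<close>. The summand 1 in the denominator makes that strict and
    covers \<open>c = 0\<close>.\<close>
  define t where "t = (1 - 2 * c) / (c\<^sup>2 + 1)"
  define r where "r = sqrt t"
  define x where "x = unit 1 + scl (of_real r) (unit 0)"
  have pos: "c\<^sup>2 + 1 > 0" using zero_le_power2[of c] by linarith
  have t: "t > 0" using c pos by (simp add: t_def)
  then have r: "r > 0" "r\<^sup>2 = t" by (simp_all add: r_def)
  interpret hilbert_space scl ell2 ell2_ip unfolding scl_def by (rule hilbert_space_ell2)
  have ip_unit: "ell2_ip y (unit k) = y k" for y k
    unfolding unit_def by (rule ell2_ip_unit)
  have unit_ell2: "unit k \<in> ell2" for k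
    by (rule ell2_finite_support[of "{k}"]) (simp_all add: unit_def)
  have e: "orthonormal_family ell2 ell2_ip e"
    unfolding orthonormal_family_def e_def hnorm_def ip_unit
    by (auto simp: unit_ell2 unit_def)
  have x_eq: "x 0 = of_real r" "x (Suc 0) = 1" "x (Suc (Suc i)) = 0" for i
    by (simp_all add: x_def unit_def scl_def)
  \<comment> \<open>Here \<open>unit 0\<close> is the coefficient sequence \<open>lam\<close>, not
    the omitted vector; the series has the single term \<open>e 0 = unit 1\<close>. The index starts
    at \<open>Suc n\<close> because the empty partial sum is 0.\<close>
  have partial: "(\<Sum>i<Suc n. scl (unit 0 i) (e i)) = unit 1" for n
    by (subst sum.lessThan_Suc_shift) (simp add: scl_def e_def unit_def fun_eq_iff)
  have "(\<lambda>n. hnorm ell2_ip ((\<Sum>i<n. scl (unit 0 i) (e i)) - unit 1)) \<longlonglongrightarrow> 0"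
    by (rule LIMSEQ_imp_Suc) (simp only: partial diff_self hnorm_zero tendsto_const)
  then have "hsuminf ell2 ell2_ip (\<lambda>i. scl (unit 0 i) (e i)) = unit 1"
    by (intro hsuminf_eqI) (simp_all add: carrier_scale unit_ell2 e_def)
  then have "x - hsuminf ell2 ell2_ip (\<lambda>i. scl (unit 0 i) (e i)) = scl (of_real r) (unit 0)"
    by (simp add: x_def)
  then have near: "hnorm ell2_ip (x - hsuminf ell2 ell2_ip (\<lambda>i. scl (unit 0 i) (e i))) \<le> r"
    using r by (simp add: hnorm_scale unit_ell2) (simp add: hnorm_def ip_unit unit_def)
  have x_ell2: "x \<in> ell2" by (simp add: x_def carrier_add carrier_scale unit_ell2)
  have "x i = 0" if "i \<notin> {0, 1}" for i using that
    by (metis One_nat_def insertCI not0_implies_Suc x_eq(3))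
  then have hnorm_x: "hnorm ell2_ip x = sqrt (t + 1)"
    using hnorm_ell2_finite_support[of "{0, 1}" x] r by (simp add: x_eq)
  have "(\<Sum>i. (norm (ell2_ip x (e i)))\<^sup>2) = (\<Sum>i\<in>{0}. (norm (ell2_ip x (e i)))\<^sup>2)"
  proof (rule suminf_finite)
    show "(norm (ell2_ip x (e i)))\<^sup>2 = 0" if "i \<notin> {0}" for i
      using that by (cases i) (simp_all add: e_def ip_unit x_eq)
  qed simp
  then have coeffs: "(\<Sum>i. (norm (ell2_ip x (e i)))\<^sup>2) = 1"
    by (simp add: e_def ip_unit x_eq)
  have "(\<Sum>i. (norm (unit 0 i))\<^sup>2) = (\<Sum>i\<in>{0}. (norm (unit 0 i))\<^sup>2)"
    by (rule suminf_finite) (simp_all add: unit_def)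
  then have lam: "(\<Sum>i. (norm (unit 0 i))\<^sup>2) = 1" by (simp add: unit_def)
  have "c\<^sup>2 * t < 1 - 2 * c" using c pos by (simp add: t_def field_simps)
  then have "t * (c\<^sup>2 * t) < t * (1 - 2 * c)" using t by (rule mult_strict_left_mono)
  then have "(1 + c * t)\<^sup>2 < t + 1" by (simp add: power2_eq_square algebra_simps)
  then have "c * t < sqrt (t + 1) - 1" using real_less_rsqrt by fastforce
  then have far: "hnorm ell2_ip x - sqrt (\<Sum>i. (norm (ell2_ip x (e i)))\<^sup>2)
      > c * (r\<^sup>2 / sqrt (\<Sum>i. (norm (unit 0 i))\<^sup>2))"
    by (simp add: hnorm_x coeffs lam r)
  have "unit 0 \<noteq> (\<lambda>i. 0)" by (auto simp: unit_def fun_eq_iff)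
  then show ?thesis
    using hilbert_space_axioms orthonormal_family_imp_infinite_dimensional[OF e] e unit_ell2[of 0]
      r(1) x_ell2 near far by blast
qed

text \<open>The second conjunct rules out a smaller \<open>c\<close> already among spaces carried by
  sequences, which is stronger than ruling it out among all Hilbert spaces over the same
  scalars.\<close>

theorem theorem7:
  shows
    "(\<forall>(scl :: 'k::real_or_complex \<Rightarrow> 'a::ab_group_add \<Rightarrow> 'a) V ip e lam r x.
        hilbert_space scl V ip \<longrightarrow> infinite_dimensional scl V \<longrightarrow>
        orthonormal_family V ip e \<longrightarrow> lam \<in> ell2 \<longrightarrow> lam \<noteq> (\<lambda>i. 0) \<longrightarrow> r > 0 \<longrightarrow>
        x \<in> V \<longrightarrow> hnorm ip (x - hsuminf V ip (\<lambda>i. scl (lam i) (e i))) \<le> r \<longrightarrow>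
          0 \<le> hnorm ip x - sqrt (\<Sum>i. (norm (ip x (e i)))\<^sup>2) \<and>
          hnorm ip x - sqrt (\<Sum>i. (norm (ip x (e i)))\<^sup>2)
            \<le> 1 / 2 * (r\<^sup>2 / sqrt (\<Sum>i. (norm (lam i))\<^sup>2))) \<and>
     \<not> (\<exists>c < 1 / 2. \<forall>(scl :: 'k \<Rightarrow> (nat \<Rightarrow> 'k) \<Rightarrow> (nat \<Rightarrow> 'k)) V ip e lam r x.
        hilbert_space scl V ip \<longrightarrow> infinite_dimensional scl V \<longrightarrow>
        orthonormal_family V ip e \<longrightarrow> lam \<in> ell2 \<longrightarrow> lam \<noteq> (\<lambda>i. 0) \<longrightarrow> r > 0 \<longrightarrow>
        x \<in> V \<longrightarrow> hnorm ip (x - hsuminf V ip (\<lambda>i. scl (lam i) (e i))) \<le> r \<longrightarrow>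
          hnorm ip x - sqrt (\<Sum>i. (norm (ip x (e i)))\<^sup>2)
            \<le> c * (r\<^sup>2 / sqrt (\<Sum>i. (norm (lam i))\<^sup>2)))"
proof (intro conjI allI impI notI)
  fix scl :: "'k \<Rightarrow> 'a \<Rightarrow> 'a" and V ip e lam r x
  assume hs: "hilbert_space scl V ip"
    and e: "orthonormal_family V ip e" and lam: "lam \<in> ell2" "lam \<noteq> (\<lambda>i. 0)"
    and r: "(r::real) > 0" and x: "x \<in> V"
    and near: "hnorm ip (x - hsuminf V ip (\<lambda>i. scl (lam i) (e i))) \<le> r"
  interpret hilbert_space scl V ip by (rule hs)
  show "0 \<le> hnorm ip x - sqrt (\<Sum>i. (norm (ip x (e i)))\<^sup>2)"
    using bessel_summable(2)[OF e x] by simp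
  have sum: "summable (\<lambda>i. (norm (lam i))\<^sup>2)" using lam(1) by (simp add: ell2_def)
  obtain i where "lam i \<noteq> 0" using lam(2) by blast
  \<comment> \<open>A single nonzero entry makes the norm of \<open>lam\<close> positive, so the
    final estimate can be divided by it.\<close>
  then have pos: "sqrt (\<Sum>i. (norm (lam i))\<^sup>2) > 0" using suminf_pos2[OF sum, of i] by simp
  have "2 * sqrt (\<Sum>i. (norm (lam i))\<^sup>2) * (hnorm ip x - sqrt (\<Sum>i. (norm (ip x (e i)))\<^sup>2))
      \<le> (hnorm ip (x - hsuminf V ip (\<lambda>i. scl (lam i) (e i))))\<^sup>2"
    by (rule hnorm_diff_hsuminf_ge[OF e lam(1) x])
  also have "\<dots> \<le> r\<^sup>2" using near by (intro power_mono) simp_all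
  finally show "hnorm ip x - sqrt (\<Sum>i. (norm (ip x (e i)))\<^sup>2)
      \<le> 1 / 2 * (r\<^sup>2 / sqrt (\<Sum>i. (norm (lam i))\<^sup>2))"
    using pos by (simp add: field_simps)
next
  assume "\<exists>c < 1 / 2. \<forall>(scl :: 'k \<Rightarrow> (nat \<Rightarrow> 'k) \<Rightarrow> (nat \<Rightarrow> 'k)) V ip e lam r x.
        hilbert_space scl V ip \<longrightarrow> infinite_dimensional scl V \<longrightarrow>
        orthonormal_family V ip e \<longrightarrow> lam \<in> ell2 \<longrightarrow> lam \<noteq> (\<lambda>i. 0) \<longrightarrow> r > 0 \<longrightarrow>
        x \<in> V \<longrightarrow> hnorm ip (x - hsuminf V ip (\<lambda>i. scl (lam i) (e i))) \<le> r \<longrightarrow>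
          hnorm ip x - sqrt (\<Sum>i. (norm (ip x (e i)))\<^sup>2)
            \<le> c * (r\<^sup>2 / sqrt (\<Sum>i. (norm (lam i))\<^sup>2))"
  then show False using constant_half_optimal[where ?'k = 'k] by (meson not_le)
qed

end
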